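(* The following assertions hold: (a) The family $\mathfrak{A}=\{\mathfrak{A}_\alpha\}_{\alpha\in(-\infty,1]}$ is a filtration of $\mathcal{G}_0$ with $\mathfrak{A}_{-\infty}:=\bigcap_{\alpha<1}\mathfrak{A}_\alpha=\{\mathrm{Id}\}$, $\mathfrak{A}_0=\mathcal{R}$ and $\mathfrak{A}_1=\mathcal{G}_0$. (b) For every $\alpha\in(-\infty,1]$ the function $f_\alpha$ is totally extremal for $\mathfrak{A}_\alpha$ (that is, the filtration $\mathfrak{A}$ admits the net $\{f_\alpha\}_{\alpha\in(-\infty,1]}$ of totally extremal functions). (c) For every $\alpha\in(-\infty,1]$ we have $f_\alpha\in\partial\mathfrak{A}_\alpha$. Consequently, the filtration $\mathfrak{A}$ is strict.
   Context: Let $\mathbb{D}$ be the open unit disk. $\mathcal{A}$ is the set of holomorphic $f:\mathbb{D}\to\mathbb{C}$ with $f(0)=0$, $f'(0)=1$; $\mathrm{Id}$ is the identity map; quotients $f(z)/z$ are extended by their limit at $0$. $\mathcal{P}$ is the set of holomorphic $q$ on $\mathbb{D}$ with $q(0)=1$, $\operatorname{Re}q>0$. $\mathcal{G}_0=\{f\in\mathcal{A}:f(z)/z\in\mathcal{P}\}$ and $\mathcal{R}=\{f\in\mathcal{A}:f'\in\mathcal{P}\}$. For $\alpha\le1$, $$\mathfrak{A}_\alpha=\left\{f\in\mathcal{A}:\ \operatorname{Re}\left[\alpha\frac{f(z)}{z}+(1-\alpha)f'(z)\right]\ge0,\ z\in\mathbb{D}\setminus\{0\}\right\}.$$ $F_1(z)=\frac{1+z}{1-z}$;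 for $\alpha<1$, $F_\alpha(z)=\int_0^1 F_1(s^{1-\alpha}z)\,ds=1+\sum_{n\ge1}\frac{2}{n(1-\alpha)+1}z^n$; and $f_\alpha(z)=zF_\alpha(-z)$ for $\alpha\le1$. A filtration of $\mathcal{G}_0$ (indexed by a connected $J\subset\mathbb{R}$) is a family $\{\mathfrak{F}_s\}_{s\in J}$ of subsets of $\mathcal{G}_0$ with $\mathfrak{F}_s\subseteq\mathfrak{F}_t$ for $s\le t$. It is strict if $\mathfrak{F}_s\subsetneq\mathfrak{F}_t$ for $s<t$. The boundary is $\partial\mathfrak{F}_t=\mathfrak{F}_t\setminus\bigcup_{s\in J,\,s<t}\mathfrak{F}_s$. A function $f_*\in\mathcal{F}\subset\mathcal{A}$ is totally extremal for $\mathcal{F}$ if for all $c\in\mathbb{C}$, $r\in[0,1)$ and $f\in\mathcal{F}$: $\min_{|z|=r}\operatorname{Re}\left(c\frac{f(z)}{z}\right)\ge\min_{|z|=r}\operatorname{Re}\left(c\frac{f_*(z)}{z}\right)$. *)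

theory Defs
  imports "HOL-Complex_Analysis.Complex_Analysis"
begin

text \<open>
  A function on the open unit disk is represented by the unique total function that agrees with
  it on the disk and is \<^const>\<open>undefined\<close> elsewhere (\<^const>\<open>extensional\<close>), so that equality in
  HOL of two such functions is equality on the disk.
\<close>

abbreviation unit_disk :: "complex set" where
  "unit_disk \<equiv> ball 0 1"

definition disk_id :: "complex \<Rightarrow> complex" where
  "disk_id = (\<lambda>z\<in>unit_disk. z)"

definition class_A :: "(complex \<Rightarrow> complex) set" where
  "class_A = {f. f \<in> extensional unit_disk \<and> f holomorphic_on unit_disk \<and> f 0 = 0 \<and> deriv f 0 = 1}"

definition quot :: "(complex \<Rightarrow> complex) \<Rightarrow> complex \<Rightarrow> complex" where
  "quot f = (\<lambda>z\<in>unit_disk. if z = 0 then Lim (at 0) (\<lambda>w. f w / w) else f z / z)"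

definition disk_deriv :: "(complex \<Rightarrow> complex) \<Rightarrow> complex \<Rightarrow> complex" where
  "disk_deriv f = (\<lambda>z\<in>unit_disk. deriv f z)"

definition class_P :: "(complex \<Rightarrow> complex) set" where
  "class_P = {q. q \<in> extensional unit_disk \<and> q holomorphic_on unit_disk \<and> q 0 = 1 \<and>
                 (\<forall>z\<in>unit_disk. Re (q z) > 0)}"

definition class_G0 :: "(complex \<Rightarrow> complex) set" where
  "class_G0 = {f \<in> class_A. quot f \<in> class_P}"

definition class_R :: "(complex \<Rightarrow> complex) set" where
  "class_R = {f \<in> class_A. disk_deriv f \<in> class_P}"

definition frakA :: "real \<Rightarrow> (complex \<Rightarrow> complex) set" where
  "frakA \<alpha> = {f \<in> class_A. \<forall>z\<in>unit_disk - {0}.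
                Re (of_real \<alpha> * (f z / z) + of_real (1 - \<alpha>) * deriv f z) \<ge> 0}"

definition F1 :: "complex \<Rightarrow> complex" where
  "F1 z = (1 + z) / (1 - z)"

definition F_fun :: "real \<Rightarrow> complex \<Rightarrow> complex" where
  "F_fun \<alpha> z = (if \<alpha> = 1 then F1 z
                else integral {0..1} (\<lambda>s::real. F1 (of_real (s powr (1 - \<alpha>)) * z)))"

definition f_fun :: "real \<Rightarrow> complex \<Rightarrow> complex" where
  "f_fun \<alpha> = (\<lambda>z\<in>unit_disk. z * F_fun \<alpha> (- z))"

definition filtration_G0 :: "real set \<Rightarrow> (real \<Rightarrow> (complex \<Rightarrow> complex) set) \<Rightarrow> bool" where
  "filtration_G0 J \<FF> \<longleftrightarrow> connected J \<and> (\<forall>s\<in>J. \<FF> s \<subseteq> class_G0) \<and>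
     (\<forall>s\<in>J. \<forall>t\<in>J. s \<le> t \<longrightarrow> \<FF> s \<subseteq> \<FF> t)"

definition strict_filtration_G0 :: "real set \<Rightarrow> (real \<Rightarrow> (complex \<Rightarrow> complex) set) \<Rightarrow> bool" where
  "strict_filtration_G0 J \<FF> \<longleftrightarrow> filtration_G0 J \<FF> \<and>
     (\<forall>s\<in>J. \<forall>t\<in>J. s < t \<longrightarrow> \<FF> s \<subset> \<FF> t)"

definition filtration_boundary ::
    "real set \<Rightarrow> (real \<Rightarrow> (complex \<Rightarrow> complex) set) \<Rightarrow> real \<Rightarrow> (complex \<Rightarrow> complex) set" where
  "filtration_boundary J \<FF> t = \<FF> t - \<Union> {\<FF> s | s. s \<in> J \<and> s < t}"

text \<open>
  The minimum over a circle is written as an infimum; it is attained, see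
  \<open>min_on_circle_attained\<close> below.
\<close>

definition min_on_circle :: "complex \<Rightarrow> real \<Rightarrow> (complex \<Rightarrow> complex) \<Rightarrow> real" where
  "min_on_circle c r f = (INF z\<in>sphere 0 r. Re (c * quot f z))"

definition totally_extremal :: "(complex \<Rightarrow> complex) \<Rightarrow> (complex \<Rightarrow> complex) set \<Rightarrow> bool" where
  "totally_extremal fs \<F> \<longleftrightarrow> \<F> \<subseteq> class_A \<and> fs \<in> \<F> \<and>
     (\<forall>c. \<forall>r\<in>{0..<1}. \<forall>f\<in>\<F>. min_on_circle c r f \<ge> min_on_circle c r fs)"

lemma min_on_circle_attained:
  assumes "f \<in> class_A" "r \<in> {0..<1}"
  obtains z where "z \<in> sphere 0 r" "min_on_circle c r f = Re (c * quot f z)"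
    "\<And>w. w \<in> sphere 0 r \<Longrightarrow> Re (c * quot f z) \<le> Re (c * quot f w)"
proof -
  have hol: "f holomorphic_on unit_disk" using assms(1) by (simp add: class_A_def)
  have r: "0 \<le> r" "r < 1" using assms(2) by auto
  have "continuous_on (sphere 0 r) (\<lambda>z. Re (c * quot f z))"
  proof (cases "r = 0")
    case True
    then show ?thesis by simp
  next
    case False
    have sub: "sphere 0 r \<subseteq> unit_disk" using r by auto
    have "continuous_on (sphere 0 r) (\<lambda>z. Re (c * (f z / z)))"
      using holomorphic_on_imp_continuous_on[OF holomorphic_on_subset[OF hol sub]] False
      by (intro continuous_intros) auto
    moreover have "Re (c * (f z / z)) = Re (c * quot f z)" if "z \<in> sphere 0 r" for z
    proof -
      from that False r have "quot f z = f z / z" by (auto simp: quot_def)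
      then show ?thesis by (simp only:)
    qed
    ultimately show ?thesis by (rule continuous_on_eq)
  qed
  then have "\<exists>z\<in>sphere 0 r. \<forall>w\<in>sphere 0 r. Re (c * quot f z) \<le> Re (c * quot f w)"
    using r by (intro continuous_attains_inf) (simp_all only: compact_sphere sphere_eq_empty)
  then obtain z where z: "z \<in> sphere 0 r"
      and le: "\<And>w. w \<in> sphere 0 r \<Longrightarrow> Re (c * quot f z) \<le> Re (c * quot f w)"
    by (elim bexE) (rule that, assumption, erule bspec)
  have "min_on_circle c r f = Re (c * quot f z)"
    unfolding min_on_circle_def
  proof (rule cInf_eq_minimum)
    show "Re (c * quot f z) \<in> (\<lambda>z. Re (c * quot f z)) ` sphere 0 r"
      using z by (rule imageI)
  next
    fix x assume "x \<in> (\<lambda>z. Re (c * quot f z)) ` sphere 0 r"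
    then obtain w where "w \<in> sphere 0 r" "x = Re (c * quot f w)" by (rule imageE)
    then show "Re (c * quot f z) \<le> x" using le by (simp only:)
  qed
  with z show ?thesis using le by (rule that)
qed

end

theory Submission
  imports Defs
begin

text \<open>
  Put \<open>p = f(z)/z\<close>, \<open>b = 1 - \<alpha>\<close> and \<open>q = p + b z p'\<close>; then \<open>f\<close> lies in \<open>frakA \<alpha>\<close> iff
  \<open>Re q \<ge> 0\<close>. Since \<open>q(s\<^sup>b z)\<close> is the derivative in \<open>s\<close> of \<open>s p(s\<^sup>b z)\<close>, \<open>p(z)\<close> is the mean of
  \<open>q(s\<^sup>b z)\<close> over \<open>0 \<le> s \<le> 1\<close>, so \<open>Re p \<ge> 0\<close>; the classes increase in \<open>\<alpha>\<close> because the quantities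
  \<open>q\<close> for larger \<open>\<alpha>\<close> are convex combinations of \<open>q\<close> and \<open>p\<close>.

  The function \<open>F_fun \<alpha>\<close> solves \<open>P + b z P' = F1\<close>. Inserting the Schwarz formula for \<open>q\<close>, whose kernel
  is \<open>F1\<close>, into the mean and exchanging the integrals writes \<open>p(R z)\<close>, \<open>R < 1\<close>, as the average of
  \<open>F_fun \<alpha>\<close> over rotations of \<open>z\<close> with respect to the probability density \<open>Re q(R u)\<close>, which
  yields total extremality as \<open>R\<close> tends to \<open>1\<close>.

  If \<open>f\<close> lies in all classes, letting \<open>b\<close> grow gives \<open>Re (z p') \<ge> 0\<close>, with equality at \<open>0\<close>, hence
  \<open>p\<close> is constant. Finally \<open>q'(0) = (1 + b) p'(0)\<close>, and Caratheodory's bound \<open>\<bar>q'(0)\<bar> \<le> 2\<close>, attained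
  by \<open>f_fun \<alpha>\<close>, keeps \<open>f_fun \<alpha>\<close> out of the smaller classes.
\<close>

section \<open>Nonnegative real part: rigidity and the first coefficient\<close>

text \<open>Open mapping: the image of a nonconstant \<open>g\<close> would contain points slightly
  to the left of \<open>g w\<close>, where the real part is negative.\<close>

lemma holomorphic_const_if_Re_nonneg_zero:
  assumes g: "g holomorphic_on S" "open S" "connected S"
    and nonneg: "\<And>z. z \<in> S \<Longrightarrow> 0 \<le> Re (g z)"
    and w: "w \<in> S" "Re (g w) = 0" and z: "z \<in> S"
  shows "g z = g w"
proof -
  have "g constant_on S"
  proof (rule ccontr)
    assume "\<not> g constant_on S"
    then have "open (g ` S)"
      using open_mapping_thm[OF g g(2) order_refl] by blast
    then obtain e where e: "e > 0" "ball (g w) e \<subseteq> g ` S"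
      using w(1) by (meson imageI open_contains_ball)
    have "g w - of_real (e/2) \<in> ball (g w) e"
      using e(1) by (simp add: dist_norm)
    then obtain u where "u \<in> S" "g u = g w - of_real (e/2)"
      using e(2) by (metis imageE subsetD)
    with nonneg[of u] w(2) e(1) show False by simp
  qed
  then show ?thesis using w(1) z by (auto simp: constant_on_def)
qed

text \<open>A zero of the real part would make \<open>g\<close> constant, against its value at
  \<open>w\<close>. This bridges the weak inequality in \<open>frakA\<close> and the strict one in
  \<open>class_P\<close>.\<close>

lemma holomorphic_Re_pos:
  assumes "g holomorphic_on S" "open S" "connected S"
    and "\<And>z. z \<in> S \<Longrightarrow> 0 \<le> Re (g z)" and "w \<in> S" "0 < Re (g w)" and "z \<in> S"
  shows "0 < Re (g z)"
  using holomorphic_const_if_Re_nonneg_zero[OF assms(1-4) assms(7) _ assms(5)] assms(4,6,7)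
  by (metis less_eq_real_def)

text \<open>The Cayley transform \<open>h\<close> of \<open>q\<close> maps the disk into itself,
  since \<open>|q + 1|^2 - |q - 1|^2 = 4 Re q\<close>, and fixes 0. The Schwarz lemma bounds its
  derivative there, which is half that of \<open>q\<close>.\<close>

lemma Caratheodory_coeff_1:
  assumes q: "q holomorphic_on unit_disk" "q 0 = 1"
    and nonneg: "\<And>z. z \<in> unit_disk \<Longrightarrow> 0 \<le> Re (q z)"
  shows "norm (deriv q 0) \<le> 2"
proof -
  have pos: "0 < Re (q z)" if "z \<in> unit_disk" for z
    using holomorphic_Re_pos[OF q(1) _ _ nonneg, of 0 z] that q(2) by simp
  have nz: "q z + 1 \<noteq> 0" if "z \<in> unit_disk" for z
    using pos[OF that] by (auto simp: complex_eq_iff)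
  define h where "h z = (q z - 1) / (q z + 1)" for z
  have h: "h holomorphic_on unit_disk"
    unfolding h_def by (intro holomorphic_intros q nz) auto
  have lt: "norm (h z) < 1" if "norm z < 1" for z
  proof -
    have "(norm (q z - 1))\<^sup>2 < (norm (q z + 1))\<^sup>2"
      using pos[of z] that unfolding cmod_power2 by (simp add: power2_eq_square algebra_simps)
    then have "norm (q z - 1) < norm (q z + 1)"
      by (simp add: power2_less_imp_less)
    then show ?thesis using nz[of z] that by (simp add: h_def norm_divide divide_simps)
  qed
  have "(q has_field_derivative deriv q 0) (at 0)"
    using q(1) by (intro holomorphic_derivI[of q unit_disk]) auto
  then have "(h has_field_derivative deriv q 0 / 2) (at 0)"
    unfolding h_def using q(2) by (auto intro!: derivative_eq_intros simp: field_simps)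
  then have "deriv h 0 = deriv q 0 / 2" by (rule DERIV_imp_deriv)
  moreover have "h 0 = 0" using q(2) by (simp add: h_def)
  then have "norm (deriv h 0) \<le> 1" using Schwarz_Lemma(2)[OF h _ lt, of 0] by simp
  ultimately show ?thesis by (simp only: norm_divide) simp
qed

section \<open>The operator \<open>p + b z p'\<close> and its inversion by a mean\<close>

definition euler_op :: "real \<Rightarrow> (complex \<Rightarrow> complex) \<Rightarrow> complex \<Rightarrow> complex" where
  "euler_op b p z = p z + of_real b * z * deriv p z"

text \<open>At \<open>b = 0\<close> this differs from \<open>s powr b\<close> by the junk value \<open>0 powr 0 = 0\<close>, which would
  spoil continuity at \<open>s = 0\<close>.\<close>

definition dil :: "real \<Rightarrow> real \<Rightarrow> real" where
  "dil b s = (if b = 0 then 1 else s powr b)"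

lemma dil_bounds:
  assumes "0 \<le> b" "s \<in> {0..1}" shows "0 \<le> dil b s" "dil b s \<le> 1"
  using assms by (auto simp: dil_def powr_le1)

lemma continuous_on_dil: "0 \<le> b \<Longrightarrow> continuous_on {0..1} (dil b)"
  unfolding dil_def
  by (cases "b = 0") (auto intro!: continuous_on_powr' continuous_on_id continuous_on_const)

lemma dil_mult_in_disk:
  assumes "0 \<le> b" "s \<in> {0..1}" "z \<in> unit_disk"
  shows "of_real (dil b s) * z \<in> unit_disk"
proof -
  have "dil b s * norm z \<le> 1 * norm z"
    using dil_bounds[OF assms(1,2)] by (intro mult_right_mono) auto
  then show ?thesis using dil_bounds[OF assms(1,2)] assms(3) by (simp add: norm_mult)
qed

lemma holomorphic_euler_op:
  "p holomorphic_on S \<Longrightarrow> open S \<Longrightarrow> euler_op b p holomorphic_on S"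
  unfolding euler_op_def by (intro holomorphic_intros)

lemma has_integral_euler_op:
  assumes b: "0 \<le> b" and p: "p holomorphic_on unit_disk" and z: "z \<in> unit_disk"
  shows "((\<lambda>s. euler_op b p (of_real (dil b s) * z)) has_integral p z) {0..1}"
proof (cases "b = 0")
  case True
  then show ?thesis
    using has_integral_const_real[of "p z" 0 1] by (simp add: euler_op_def dil_def)
next
  case False
  let ?g = "\<lambda>s. of_real (dil b s) * z"
  let ?F = "\<lambda>s. of_real s * p (?g s)"
  have "continuous_on {0..1} ?F"
    by (intro continuous_intros continuous_on_compose2[OF holomorphic_on_imp_continuous_on[OF p]]
        continuous_on_dil b) (use dil_mult_in_disk[OF b _ z] in auto)
  moreover have "(?F has_vector_derivative euler_op b p (?g s)) (at s)" if s: "s \<in> {0<..<1}" for s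
  proof -
    have "(dil b has_real_derivative b * s powr (b - 1)) (at s)"
      using False s unfolding dil_def by (auto intro!: derivative_eq_intros)
    then have g: "(?g has_vector_derivative of_real (b * s powr (b - 1)) * z) (at s)"
      by (intro has_vector_derivative_mult_left has_vector_derivative_of_real)
        (simp add: has_real_derivative_iff_has_vector_derivative)
    have "(p has_field_derivative deriv p (?g s)) (at (?g s))"
      using dil_mult_in_disk[OF b _ z, of s] s
      by (intro holomorphic_derivI[OF p]) auto
    from field_vector_diff_chain_at[OF g this]
    have pg: "((\<lambda>s. p (?g s)) has_vector_derivative
        of_real (b * s powr (b - 1)) * z * deriv p (?g s)) (at s)"
      by (simp add: o_def)
    have id: "((\<lambda>s. of_real s :: complex) has_vector_derivative of_real 1) (at s)"
      by (intro has_vector_derivative_of_real) (auto intro!: derivative_eq_intros)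
    have "s powr b = s * s powr (b - 1)"
      using s by (simp add: powr_diff)
    then have "of_real s * (of_real (b * s powr (b - 1)) * z * deriv p (?g s)) + of_real 1 * p (?g s)
      = euler_op b p (?g s)"
      using False by (simp add: euler_op_def dil_def)
    with has_vector_derivative_mult[OF id pg] show ?thesis by (simp only:)
  qed
  \<comment> \<open>For \<open>0 < b < 1\<close> the power \<open>s powr b\<close> has no finite
    derivative at 0, so only continuity is used at the endpoints.\<close>
  ultimately have "((\<lambda>s. euler_op b p (?g s)) has_integral ?F 1 - ?F 0) {0..1}"
    by (intro fundamental_theorem_of_calculus_interior) auto
  then show ?thesis using False by (simp add: dil_def)
qed

text \<open>Compare Taylor coefficients: \<open>F1\<close> has constant term 1 and all others 2, and
  the operator multiplies the coefficient of \<open>z ^ n\<close> by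
  \<open>1 + n * b\<close>.\<close>

lemma ex_euler_op_F1:
  assumes b: "0 \<le> b"
  shows "\<exists>P. P holomorphic_on unit_disk \<and> (\<forall>z\<in>unit_disk. euler_op b P z = F1 z)"
proof -
  define a :: "nat \<Rightarrow> complex" where "a n = of_real (if n = 0 then 1 else 2 / (n * b + 1))" for n :: nat
  define P where "P z = (\<Sum>n. a n * z ^ n)" for z :: complex
  have a_le: "norm (a n) \<le> 2" for n
  proof (cases "n = 0")
    case False
    have "1 \<le> n * b + 1" using b by simp
    then have "2 / (n * b + 1) \<le> 2" by (simp add: divide_simps)
    then show ?thesis using b False by (simp add: a_def norm_divide del: of_real_divide)
  qed (simp add: a_def)
  have summ: "summable (\<lambda>n. a n * z ^ n)" if "norm z < 1" for z
  proof (rule summable_comparison_test')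
    show "summable (\<lambda>n. 2 * norm z ^ n)" using that by (intro summable_mult summable_geometric) auto
    show "norm (a n * z ^ n) \<le> 2 * norm z ^ n" if "n \<ge> 0" for n
      using a_le[of n] by (simp add: norm_mult norm_power mult_right_mono)
  qed
  have D: "(P has_field_derivative (\<Sum>n. diffs a n * z ^ n)) (at z)" if "norm z < 1" for z
    unfolding P_def using termdiffs_strong'[OF summ that] by simp
  have "P holomorphic_on unit_disk"
    unfolding holomorphic_on_open[OF open_ball] using D by (meson mem_ball_0)
  moreover have "euler_op b P z = F1 z" if z: "z \<in> unit_disk" for z
  proof -
    have nz: "norm z < 1" using z by simp
    have "deriv P z = (\<Sum>n. diffs a n * z ^ n)" by (rule DERIV_imp_deriv[OF D[OF nz]])
    moreover have "summable (\<lambda>n. diffs a n * z ^ n)"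
      by (rule termdiff_converges[OF nz summ])
    ultimately have "(\<lambda>n. diffs a n * z ^ n) sums deriv P z"
      by (simp add: summable_sums)
    from sums_mult[OF this, of "of_real b * z"]
    have 1: "(\<lambda>n. of_real b * z * (diffs a n * z ^ n)) sums (of_real b * z * deriv P z)" .
    have "(\<lambda>n. a n * z ^ n) sums P z" using summ[OF nz] by (simp add: P_def summable_sums)
    then have "(\<lambda>n. a (Suc n) * z ^ Suc n) sums (P z - 1)"
      by (subst sums_Suc_iff) (simp add: a_def)
    from sums_add[OF this 1]
    have "(\<lambda>n. a (Suc n) * z ^ Suc n + of_real b * z * (diffs a n * z ^ n)) sums (euler_op b P z - 1)"
      by (simp add: euler_op_def algebra_simps)
    \<comment> \<open>Since \<open>diffs a n\<close> is \<open>Suc n * a (Suc n)\<close>, the two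
      terms add up to \<open>x * a (Suc n)\<close> times \<open>z ^ Suc n\<close>, and
      \<open>x\<close> is the denominator of \<open>a (Suc n)\<close>.\<close>
    moreover have "a (Suc n) * z ^ Suc n + of_real b * z * (diffs a n * z ^ n) = 2 * z * z ^ n" for n
    proof -
      define x where "x = Suc n * b + 1"
      have "0 \<le> Suc n * b" using b by (intro mult_nonneg_nonneg) auto
      then have "x \<noteq> 0" unfolding x_def by linarith
      moreover have "a (Suc n) = of_real (2 / x)" by (simp add: a_def x_def)
      ultimately have "of_real x * a (Suc n) = 2" by simp
      then have "(a (Suc n) + of_real b * of_nat (Suc n) * a (Suc n)) * (z * z ^ n) = 2 * (z * z ^ n)"
        by (simp add: x_def algebra_simps)
      then show ?thesis by (simp add: diffs_def algebra_simps)
    qed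
    ultimately have "(\<lambda>n. 2 * z * z ^ n) sums (euler_op b P z - 1)" by simp
    moreover have "(\<lambda>n. 2 * z * z ^ n) sums (2 * z * (1 / (1 - z)))"
      by (intro sums_mult geometric_sums nz)
    ultimately have "euler_op b P z - 1 = 2 * z * (1 / (1 - z))" by (rule sums_unique2)
    moreover have "1 - z \<noteq> 0" using nz by auto
    ultimately show ?thesis by (simp add: F1_def field_simps)
  qed
  ultimately show ?thesis by blast
qed

text \<open>Uniqueness: the mean formula recovers a holomorphic solution from \<open>F1\<close>, and
  that mean is the integral in \<open>F_fun\<close>.\<close>

lemma F_fun_eqI:
  assumes \<alpha>: "\<alpha> \<le> 1" and P: "P holomorphic_on unit_disk"
    and F1: "\<And>z. z \<in> unit_disk \<Longrightarrow> euler_op (1 - \<alpha>) P z = F1 z" and z: "z \<in> unit_disk"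
  shows "P z = F_fun \<alpha> z"
proof -
  have "((\<lambda>s. F1 (of_real (dil (1 - \<alpha>) s) * z)) has_integral P z) {0..1}"
    by (rule has_integral_eq[OF _ has_integral_euler_op[of "1 - \<alpha>" P z]])
      (use \<alpha> z P F1 dil_mult_in_disk[of "1 - \<alpha>" _ z] in auto)
  \<comment> \<open>This serves \<open>\<alpha> = 1\<close>, where \<open>F_fun\<close> is defined
    by a separate branch.\<close>
  moreover have "((\<lambda>s. F1 (of_real (dil 0 s) * z)) has_integral F1 z) {0..1}"
    using has_integral_const_real[of "F1 z" 0 1] by (simp add: dil_def)
  ultimately show ?thesis
    by (cases "\<alpha> = 1") (auto simp: F_fun_def dil_def has_integral_iff)
qed

text \<open>The power series solution equals the integral on the disk, so its holomorphy and its
  equation carry over without differentiation under the integral sign.\<close>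

lemma
  assumes \<alpha>: "\<alpha> \<le> 1"
  shows holomorphic_F_fun: "F_fun \<alpha> holomorphic_on unit_disk"
    and euler_op_F_fun: "z \<in> unit_disk \<Longrightarrow> euler_op (1 - \<alpha>) (F_fun \<alpha>) z = F1 z"
proof -
  obtain P where P: "P holomorphic_on unit_disk" "\<And>z. z \<in> unit_disk \<Longrightarrow> euler_op (1 - \<alpha>) P z = F1 z"
    using ex_euler_op_F1[of "1 - \<alpha>"] \<alpha> by auto
  have eq: "P z = F_fun \<alpha> z" if z: "z \<in> unit_disk" for z
    using F_fun_eqI[OF \<alpha> P z] .
  show hol: "F_fun \<alpha> holomorphic_on unit_disk"
    using holomorphic_transform[OF P(1) eq] by simp
  show "euler_op (1 - \<alpha>) (F_fun \<alpha>) z = F1 z" if z: "z \<in> unit_disk"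
  proof -
    have "deriv P z = deriv (F_fun \<alpha>) z"
      by (rule complex_derivative_transform_within_open[OF P(1) hol open_ball z eq])
    with P(2)[OF z] eq[OF z] show ?thesis by (simp add: euler_op_def)
  qed
qed

lemma has_integral_F_fun:
  assumes \<alpha>: "\<alpha> \<le> 1" and z: "z \<in> unit_disk"
  shows "((\<lambda>s. F1 (of_real (dil (1 - \<alpha>) s) * z)) has_integral F_fun \<alpha> z) {0..1}"
  by (rule has_integral_eq[OF _ has_integral_euler_op[OF _ holomorphic_F_fun[OF \<alpha>] z, of "1 - \<alpha>"]])
    (use \<alpha> z euler_op_F_fun[OF \<alpha>] dil_mult_in_disk[of "1 - \<alpha>" _ z] in auto)

subsection \<open>Integral representations on the circle\<close>

lemma norm_circlepath_0_1 [simp]: "norm (circlepath 0 1 t) = 1"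
  by (simp add: circlepath norm_exp_eq_Re)

lemma circlepath_0_1_mult_cnj: "circlepath 0 1 t * cnj (circlepath 0 1 t) = 1"
  by (simp add: complex_norm_square[symmetric])

lemma continuous_on_circlepath [continuous_intros]:
  "continuous_on S f \<Longrightarrow> continuous_on S (\<lambda>x. circlepath z r (f x))"
  unfolding circlepath by (intro continuous_intros)

text \<open>On the circle \<open>du = 2 pi i u dt\<close>, so Cauchy's formula becomes a mean over
  \<open>t\<close> with weight \<open>u / (u - z)\<close>.\<close>

lemma has_integral_Cauchy_circle:
  assumes "continuous_on (cball 0 1) g" "g holomorphic_on unit_disk" "z \<in> unit_disk"
  shows "((\<lambda>t. g (circlepath 0 1 t) * (circlepath 0 1 t / (circlepath 0 1 t - z))) has_integral g z) {0..1}"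
proof -
  define k where "k = 2 * of_real pi * \<i>"
  have k: "k \<noteq> 0" by (simp add: k_def)
  have "((\<lambda>u. g u / (u - z)) has_contour_integral k * g z) (circlepath 0 1)"
    using Cauchy_integral_circlepath[OF assms(1,2), of z] assms(3) by (simp add: k_def)
  moreover have "vector_derivative (circlepath 0 1) (at t within {0..1}) = k * circlepath 0 1 t"
    if "t \<in> {0..1}" for t
    using that by (subst vector_derivative_circlepath01) (auto simp: k_def circlepath)
  ultimately have "((\<lambda>t. g (circlepath 0 1 t) / (circlepath 0 1 t - z) * (k * circlepath 0 1 t))
      has_integral k * g z) {0..1}"
    unfolding has_contour_integral_def by (subst (asm) has_integral_cong) (simp_all only:)
  from has_integral_mult_right[OF this, of "1 / k"] show ?thesis
    using k by (simp add: mult_ac)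
qed

lemma has_integral_circle_mean:
  assumes "continuous_on (cball 0 1) g" "g holomorphic_on unit_disk"
  shows "((\<lambda>t. g (circlepath 0 1 t)) has_integral g 0) {0..1}"
proof -
  have "circlepath 0 1 t \<noteq> 0" for t :: real by (metis norm_circlepath_0_1 norm_zero zero_neq_one)
  then show ?thesis using has_integral_Cauchy_circle[OF assms, of 0] by simp
qed

text \<open>The kernel \<open>F1 (cnj u * z) = 2 * u / (u - z) - 1\<close> reproduces \<open>g\<close> by Cauchy's formula, while
  the conjugate of \<open>g\<close> only contributes its value at the centre, because the conjugate of the
  kernel is holomorphic in \<open>u\<close>.\<close>

lemma Schwarz_integral_formula:
  assumes g: "continuous_on (cball 0 1) g" "g holomorphic_on unit_disk" and im: "Im (g 0) = 0"
    and z: "z \<in> unit_disk"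
  shows "((\<lambda>t. of_real (Re (g (circlepath 0 1 t))) * F1 (cnj (circlepath 0 1 t) * z))
    has_integral g z) {0..1}"
proof -
  let ?e = "circlepath 0 1"
  have ne: "1 - cnj z * w \<noteq> 0" if "w \<in> cball 0 1" for w
  proof
    assume "1 - cnj z * w = 0"
    then have "norm (cnj z * w) = 1" by (simp add: algebra_simps)
    moreover have "norm z * norm w \<le> norm z * 1" using that by (intro mult_left_mono) auto
    ultimately show False using z by (simp add: norm_mult)
  qed
  let ?G = "\<lambda>w. g w * F1 (cnj z * w)"
  have "((\<lambda>t. ?G (?e t)) has_integral ?G 0) {0..1}"
  proof (rule has_integral_circle_mean)
    show "continuous_on (cball 0 1) ?G"
      unfolding F1_def by (intro continuous_intros g(1)) (use ne in auto)
    show "?G holomorphic_on unit_disk"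
      unfolding F1_def by (intro holomorphic_intros g(2)) (use ne in auto)
  qed
  from has_integral_linear[OF this bounded_linear_cnj]
  have conj: "((\<lambda>t. cnj (?G (?e t))) has_integral cnj (?G 0)) {0..1}"
    by (simp add: o_def)
  have g0: "cnj (?G 0) = g 0" using im by (simp add: F1_def complex_eq_iff)
  \<comment> \<open>\<open>Re g\<close> is half of \<open>g + cnj g\<close>. Against the kernel,
    \<open>g\<close> yields \<open>2 * g z - g 0\<close> and \<open>cnj g\<close> yields
    \<open>g 0\<close>, which is real.\<close>
  have "((\<lambda>t. (2 * (g (?e t) * (?e t / (?e t - z))) - g (?e t) + cnj (?G (?e t))) * (1/2))
      has_integral (2 * g z - g 0 + g 0) * (1/2)) {0..1}"
    using conj unfolding g0
    by (intro has_integral_mult_left has_integral_add has_integral_diff has_integral_mult_right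
        has_integral_Cauchy_circle has_integral_circle_mean g z)
  moreover have "(2 * (g (?e t) * (?e t / (?e t - z))) - g (?e t) + cnj (?G (?e t))) * (1/2)
      = of_real (Re (g (?e t))) * F1 (cnj (?e t) * z)" for t
  proof -
    have ne': "1 - cnj (?e t) * z \<noteq> 0"
      using ne[of "?e t"] by (metis norm_circlepath_0_1 complex_cnj_cnj complex_cnj_diff complex_cnj_mult
          complex_cnj_one complex_cnj_zero_iff mem_cball_0 mult.commute order_refl)
    have "?e t - z = ?e t * (1 - cnj (?e t) * z)"
      using circlepath_0_1_mult_cnj[of t] by (simp add: algebra_simps)
    moreover have "?e t \<noteq> 0" by (metis norm_circlepath_0_1 norm_zero zero_neq_one)
    ultimately have "2 * (?e t / (?e t - z)) - 1 = 2 / (1 - cnj (?e t) * z) - 1"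
      by simp
    also have "\<dots> = F1 (cnj (?e t) * z)"
      using ne' by (simp add: F1_def field_simps)
    finally have k: "2 * (?e t / (?e t - z)) - 1 = F1 (cnj (?e t) * z)" .
    have "cnj (F1 (cnj z * ?e t)) = F1 (cnj (?e t) * z)"
      by (simp add: F1_def mult.commute)
    moreover have "2 * (g (?e t) * (?e t / (?e t - z))) - g (?e t)
        = g (?e t) * (2 * (?e t / (?e t - z)) - 1)"
      by (simp add: algebra_simps)
    ultimately have "(2 * (g (?e t) * (?e t / (?e t - z))) - g (?e t) + cnj (?G (?e t))) * (1/2)
        = (g (?e t) + cnj (g (?e t))) * (1/2) * F1 (cnj (?e t) * z)"
      unfolding k by (simp add: algebra_simps)
    also have "(g (?e t) + cnj (g (?e t))) * (1/2) = of_real (Re (g (?e t)))"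
      by (simp add: complex_add_cnj)
    finally show ?thesis .
  qed
  ultimately show ?thesis by simp
qed

lemma scale_in_disk:
  assumes "0 \<le> R" "R < 1" "w \<in> cball 0 1"
  shows "of_real R * w \<in> unit_disk"
proof -
  have "R * norm w \<le> R * 1" using assms by (intro mult_left_mono) auto
  also have "\<dots> < 1" using assms(2) by simp
  finally show ?thesis using assms(1) by (simp add: norm_mult)
qed

text \<open>Shrinking the argument by \<open>R < 1\<close> provides the continuity up to the
  boundary that the circle formulas require.\<close>

lemma holomorphic_scale_disk:
  assumes h: "h holomorphic_on unit_disk" and R: "0 \<le> R" "R < 1"
  shows "continuous_on (cball 0 1) (\<lambda>w. h (of_real R * w))"
    and "(\<lambda>w. h (of_real R * w)) holomorphic_on unit_disk"
proof -
  note Rw = scale_in_disk[OF R]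
  show "continuous_on (cball 0 1) (\<lambda>w. h (of_real R * w))"
    by (intro continuous_on_compose2[OF holomorphic_on_imp_continuous_on[OF h]] continuous_intros)
      (use Rw in auto)
  show "(\<lambda>w. h (of_real R * w)) holomorphic_on unit_disk"
    by (rule holomorphic_on_compose_gen[OF _ h, unfolded o_def])
      (use Rw in \<open>auto intro!: holomorphic_intros simp del: mem_ball_0\<close>)
qed

lemma has_integral_F_fun_representation:
  assumes \<alpha>: "\<alpha> \<le> 1" and p: "p holomorphic_on unit_disk" "Im (p 0) = 0"
    and R: "0 < R" "R < 1" and z: "z \<in> unit_disk"
  shows "((\<lambda>t. of_real (Re (euler_op (1 - \<alpha>) p (of_real R * circlepath 0 1 t)))
      * F_fun \<alpha> (cnj (circlepath 0 1 t) * z)) has_integral p (of_real R * z)) {0..1}"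
proof -
  let ?e = "circlepath 0 1"
  define b where "b = 1 - \<alpha>"
  have b: "0 \<le> b" using \<alpha> by (simp add: b_def)
  define g where "g w = euler_op b p (of_real R * w)" for w
  note Rw = scale_in_disk[OF less_imp_le[OF R(1)] R(2)]
  have ez: "cnj (?e t) * w \<in> unit_disk" if "w \<in> unit_disk" for t w
    using that by (simp add: norm_mult)
  have hol: "euler_op b p holomorphic_on unit_disk"
    by (rule holomorphic_euler_op[OF p(1) open_ball])
  have gcont: "continuous_on (cball 0 1) g" and ghol: "g holomorphic_on unit_disk"
    unfolding g_def using holomorphic_scale_disk[OF hol] R by simp_all
  have gim: "Im (g 0) = 0" using p(2) by (simp add: g_def euler_op_def)
  have F1cont: "continuous_on unit_disk F1"
    unfolding F1_def by (intro continuous_intros) auto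
  let ?K = "\<lambda>s t. of_real (Re (g (?e t))) * F1 (cnj (?e t) * (of_real (dil b s) * z))"
  \<comment> \<open>Integrating first in \<open>t\<close> gives \<open>g\<close> by the Schwarz
    formula and then \<open>p\<close> by the mean formula; integrating first in \<open>s\<close>
    turns the kernel \<open>F1\<close> into \<open>F_fun \<alpha>\<close>.\<close>
  have "integral {0..1} (\<lambda>s. integral {0..1} (?K s)) = integral {0..1} (\<lambda>t. integral {0..1} (\<lambda>s. ?K s t))"
  proof -
    have "continuous_on (cbox (0,0) (1,1)) (\<lambda>(s,t). ?K s t)"
      unfolding split_beta
    proof (intro continuous_intros continuous_on_compose2[OF F1cont] continuous_on_compose2[OF gcont]
        continuous_on_compose2[OF continuous_on_dil[OF b]])
      show "(\<lambda>x. cnj (?e (snd x)) * (of_real (dil b (fst x)) * z)) ` cbox (0, 0) (1, 1) \<subseteq> unit_disk"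
        using ez[OF dil_mult_in_disk[OF b _ z]] by (auto simp del: mem_ball_0)
    qed auto
    from integral_swap_continuous[OF this] show ?thesis by simp
  qed
  moreover have "integral {0..1} (\<lambda>s. integral {0..1} (?K s)) = p (of_real R * z)"
  proof -
    have "integral {0..1} (\<lambda>s. integral {0..1} (?K s)) = integral {0..1} (\<lambda>s. g (of_real (dil b s) * z))"
      using Schwarz_integral_formula[OF gcont ghol gim dil_mult_in_disk[OF b _ z]]
      by (intro integral_cong) (simp add: integral_unique)
    also have "\<dots> = integral {0..1} (\<lambda>s. euler_op b p (of_real (dil b s) * (of_real R * z)))"
      by (simp add: g_def mult_ac)
    also have "\<dots> = p (of_real R * z)"
      using z Rw by (intro integral_unique has_integral_euler_op b p) auto
    finally show ?thesis .
  qed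
  moreover have "integral {0..1} (\<lambda>s. ?K s t) = of_real (Re (g (?e t))) * F_fun \<alpha> (cnj (?e t) * z)" for t
  proof -
    have "((\<lambda>s. F1 (of_real (dil b s) * (cnj (?e t) * z))) has_integral F_fun \<alpha> (cnj (?e t) * z)) {0..1}"
      unfolding b_def by (rule has_integral_F_fun[OF \<alpha> ez[OF z]])
    from has_integral_mult_right[OF this, of "of_real (Re (g (?e t)))"]
    show ?thesis by (intro integral_unique) (simp add: mult_ac)
  qed
  ultimately have "integral {0..1} (\<lambda>t. of_real (Re (g (?e t))) * F_fun \<alpha> (cnj (?e t) * z))
    = p (of_real R * z)" by (simp only:)
  moreover have "continuous_on {0..1} (\<lambda>t. of_real (Re (g (?e t))) * F_fun \<alpha> (cnj (?e t) * z))"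
    by (intro continuous_intros continuous_on_compose2[OF gcont]
        continuous_on_compose2[OF holomorphic_on_imp_continuous_on[OF holomorphic_F_fun[OF \<alpha>]]])
      (use ez[OF z] in auto)
  then have "(\<lambda>t. of_real (Re (g (?e t))) * F_fun \<alpha> (cnj (?e t) * z)) integrable_on {0..1}"
    by (rule integrable_continuous_real)
  ultimately show ?thesis
    by (simp add: has_integral_iff g_def b_def)
qed

text \<open>A lower bound for \<open>Re (c * F_fun \<alpha> w)\<close> on a circle survives
  averaging over rotations with nonnegative weights of mass one, and then the limit \<open>R\<close>
  to 1.\<close>

lemma Re_ge_if_F_fun_Re_ge:
  assumes \<alpha>: "\<alpha> \<le> 1" and p: "p holomorphic_on unit_disk" "p 0 = 1"
    and nonneg: "\<And>w. w \<in> unit_disk \<Longrightarrow> 0 \<le> Re (euler_op (1 - \<alpha>) p w)"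
    and z: "z \<in> unit_disk" and m: "\<And>w. norm w = norm z \<Longrightarrow> m \<le> Re (c * F_fun \<alpha> w)"
  shows "m \<le> Re (c * p z)"
proof -
  let ?e = "circlepath 0 1"
  have le: "m \<le> Re (c * p (of_real R * z))" if R: "0 < R" "R < 1" for R
  proof -
    let ?q = "\<lambda>t. euler_op (1 - \<alpha>) p (of_real R * ?e t)"
    let ?k = "\<lambda>t. of_real (Re (?q t)) * F_fun \<alpha> (cnj (?e t) * z)"
    note Rw = scale_in_disk[OF less_imp_le[OF R(1)] R(2)]
    have hol: "euler_op (1 - \<alpha>) p holomorphic_on unit_disk"
      by (rule holomorphic_euler_op[OF p(1) open_ball])
    from has_integral_circle_mean[OF holomorphic_scale_disk[OF hol less_imp_le[OF R(1)] R(2)]]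
    have "((\<lambda>t. m * Re (?q t)) has_integral m * Re (euler_op (1 - \<alpha>) p (of_real R * 0))) {0..1}"
      by (intro has_integral_mult_right has_integral_Re)
    \<comment> \<open>The weights \<open>Re (?q t)\<close> have mass one because the operator
      applied to \<open>p\<close> takes the value \<open>p 0 = 1\<close> at the centre.\<close>
    then have 1: "((\<lambda>t. m * Re (?q t)) has_integral m) {0..1}"
      using p(2) by (simp add: euler_op_def)
    have 2: "((\<lambda>t. Re (c * ?k t)) has_integral Re (c * p (of_real R * z))) {0..1}"
      using p by (intro has_integral_Re has_integral_mult_right
          has_integral_F_fun_representation \<alpha> R z) auto
    show ?thesis
    proof (rule has_integral_le[OF 1 2])
      fix t :: real assume "t \<in> {0..1}"
      have "Re (?q t) * m \<le> Re (?q t) * Re (c * F_fun \<alpha> (cnj (?e t) * z))"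
        using nonneg[OF Rw] by (intro mult_left_mono m) (auto simp: norm_mult)
      also have "\<dots> = Re (of_real (Re (?q t)) * (c * F_fun \<alpha> (cnj (?e t) * z)))"
        by simp
      also have "\<dots> = Re (c * ?k t)" by (simp only: mult.left_commute)
      finally show "m * Re (?q t) \<le> Re (c * ?k t)" by (simp only: mult.commute)
    qed
  qed
  have "isCont p z"
    using p(1) z by (meson continuous_on_eq_continuous_at holomorphic_on_imp_continuous_on open_ball)
  moreover have "((\<lambda>R. of_real R * z) \<longlongrightarrow> of_real 1 * z) (at_left (1::real))"
    by (intro tendsto_intros)
  ultimately have "((\<lambda>R. Re (c * p (of_real R * z))) \<longlongrightarrow> Re (c * p z)) (at_left (1::real))"
    by (intro tendsto_intros isCont_tendsto_compose[of _ p]) auto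
  moreover have "eventually (\<lambda>R. m \<le> Re (c * p (of_real R * z))) (at_left (1::real))"
    unfolding eventually_at_left_field using le by (intro exI[of _ 0]) auto
  ultimately show ?thesis
    by (rule tendsto_lowerbound) simp
qed


subsection \<open>The classes in terms of the quotient\<close>

text \<open>The limit in \<open>quot\<close> is \<open>deriv f 0\<close>, so \<open>quot f\<close>
  is a difference quotient at 0 with removable singularity.\<close>

lemma quot_class_A:
  assumes "f \<in> class_A"
  shows "quot f holomorphic_on unit_disk" and "quot f 0 = 1"
    and "z \<in> unit_disk \<Longrightarrow> f z = z * quot f z"
proof -
  have f: "f holomorphic_on unit_disk" "f 0 = 0" "deriv f 0 = 1"
    using assms by (auto simp: class_A_def)
  have "(f has_field_derivative deriv f 0) (at 0)"
    by (intro holomorphic_derivI[OF f(1)]) auto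
  then have "((\<lambda>w. f w / w) \<longlongrightarrow> 1) (at 0)"
    using f by (simp add: has_field_derivative_iff)
  then have "Lim (at 0) (\<lambda>w. f w / w) = 1" by (intro tendsto_Lim) auto
  then have q: "quot f z = (if z = 0 then deriv f 0 else (f z - f 0) / (z - 0))" if "z \<in> unit_disk" for z
    using that f by (simp add: quot_def)
  have "(\<lambda>z. if z = 0 then deriv f 0 else (f z - f 0) / (z - 0)) holomorphic_on unit_disk"
    by (rule pole_lemma[OF f(1)]) (simp add: interior_open)
  then show "quot f holomorphic_on unit_disk"
    by (rule holomorphic_transform) (simp only: q)
  show "quot f 0 = 1" using q[of 0] f by simp
  show "f z = z * quot f z" if "z \<in> unit_disk" using q[OF that] f by simp
qed

lemma deriv_class_A:
  assumes f: "f \<in> class_A" and z: "z \<in> unit_disk"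
  shows "deriv f z = euler_op 1 (quot f) z"
proof -
  have "(quot f has_field_derivative deriv (quot f) z) (at z)"
    by (intro holomorphic_derivI[OF quot_class_A(1)[OF f]] z open_ball)
  then have "((\<lambda>z. z * quot f z) has_field_derivative euler_op 1 (quot f) z) (at z)"
    by (auto intro!: derivative_eq_intros simp: euler_op_def)
  then have "(f has_field_derivative euler_op 1 (quot f) z) (at z)"
    by (rule has_field_derivative_transform_within_open[OF _ open_ball z])
      (simp add: quot_class_A(3)[OF f])
  then show ?thesis by (rule DERIV_imp_deriv)
qed

lemma euler_op_quot_0: "f \<in> class_A \<Longrightarrow> euler_op b (quot f) 0 = 1"
  by (simp add: euler_op_def quot_class_A)

text \<open>Writing \<open>f = z p\<close> gives \<open>f' = p + z p'\<close>, and the defining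
  expression becomes \<open>p + (1 - \<alpha>) z p'\<close>. Its value at 0 is 1, so the condition
  extends to the whole disk.\<close>

lemma frakA_iff:
  "f \<in> frakA \<alpha> \<longleftrightarrow> f \<in> class_A \<and> (\<forall>z\<in>unit_disk. 0 \<le> Re (euler_op (1 - \<alpha>) (quot f) z))"
proof (cases "f \<in> class_A")
  case True
  have "of_real \<alpha> * (f z / z) + of_real (1 - \<alpha>) * deriv f z = euler_op (1 - \<alpha>) (quot f) z"
    if "z \<in> unit_disk - {0}" for z
    using that by (simp add: deriv_class_A[OF True] quot_class_A(3)[OF True] euler_op_def algebra_simps)
  then have "f \<in> frakA \<alpha> \<longleftrightarrow> (\<forall>z\<in>unit_disk - {0}. 0 \<le> Re (euler_op (1 - \<alpha>) (quot f) z))"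
    using True by (simp only: frakA_def mem_Collect_eq simp_thms cong: ball_cong)
  moreover have "0 \<le> Re (euler_op (1 - \<alpha>) (quot f) 0)" by (simp add: euler_op_quot_0[OF True])
  ultimately show ?thesis using True by blast
qed (simp add: frakA_def)

lemma frakA_Re_quot_nonneg:
  assumes f: "f \<in> frakA \<alpha>" and \<alpha>: "\<alpha> \<le> 1" and z: "z \<in> unit_disk"
  shows "0 \<le> Re (quot f z)"
proof -
  have fA: "f \<in> class_A" using f by (simp add: frakA_iff)
  have "((\<lambda>s. Re (euler_op (1 - \<alpha>) (quot f) (of_real (dil (1 - \<alpha>) s) * z))) has_integral Re (quot f z)) {0..1}"
    using \<alpha> z by (intro has_integral_Re has_integral_euler_op quot_class_A fA) auto
  then show ?thesis
    by (rule has_integral_nonneg)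
      (use f \<alpha> z dil_mult_in_disk[of "1 - \<alpha>" _ z] in \<open>auto simp: frakA_iff\<close>)
qed

lemma frakA_mono:
  assumes "\<alpha> \<le> \<beta>" "\<beta> \<le> 1"
  shows "frakA \<alpha> \<subseteq> frakA \<beta>"
proof
  fix f assume f: "f \<in> frakA \<alpha>"
  show "f \<in> frakA \<beta>"
  \<comment> \<open>In the remaining case \<open>1 - \<alpha>\<close> is positive, so the weight
    \<open>l\<close> of the convex combination is well defined.\<close>
  proof (cases "\<alpha> = \<beta>")
    case False
    define l where "l = (1 - \<beta>) / (1 - \<alpha>)"
    have l: "0 \<le> l" "l \<le> 1" "1 - \<beta> = l * (1 - \<alpha>)"
      using assms False by (auto simp: l_def field_simps)
    have "0 \<le> Re (euler_op (1 - \<beta>) (quot f) z)" if z: "z \<in> unit_disk" for z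
    proof -
      have "euler_op (1 - \<beta>) (quot f) z
          = of_real l * euler_op (1 - \<alpha>) (quot f) z + of_real (1 - l) * quot f z"
        unfolding l(3) by (simp add: euler_op_def algebra_simps)
      then have "Re (euler_op (1 - \<beta>) (quot f) z)
          = l * Re (euler_op (1 - \<alpha>) (quot f) z) + (1 - l) * Re (quot f z)"
        by (simp del: of_real_diff)
      then show ?thesis
        using l f z frakA_Re_quot_nonneg[OF f] assms by (simp add: frakA_iff)
    qed
    then show ?thesis using f by (simp add: frakA_iff)
  qed (use f in simp)
qed

text \<open>For \<open>b = 0\<close> the operator is the identity; strict positivity follows from
  the value 1 at the origin.\<close>

lemma frakA_1: "frakA 1 = class_G0"
proof -
  have "quot f \<in> class_P \<longleftrightarrow> (\<forall>z\<in>unit_disk. 0 \<le> Re (quot f z))" if f: "f \<in> class_A" for f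
  proof
    show "quot f \<in> class_P" if nonneg: "\<forall>z\<in>unit_disk. 0 \<le> Re (quot f z)"
    proof -
      have "0 < Re (quot f z)" if "z \<in> unit_disk" for z
        using holomorphic_Re_pos[OF quot_class_A(1)[OF f] open_ball connected_ball, of 0 z]
          nonneg that quot_class_A(2)[OF f] by simp
      moreover have "quot f \<in> extensional unit_disk" by (simp add: quot_def)
      ultimately show ?thesis using quot_class_A[OF f] by (simp add: class_P_def)
    qed
  qed (auto simp: class_P_def intro: less_imp_le)
  then show ?thesis
    by (auto simp: frakA_iff class_G0_def euler_op_def)
qed

text \<open>For \<open>b = 1\<close> the operator applied to \<open>quot f\<close> is the derivative
  of \<open>f\<close>, with value 1 at the origin.\<close>

lemma frakA_0: "frakA 0 = class_R"
proof -
  have "disk_deriv f \<in> class_P \<longleftrightarrow> (\<forall>z\<in>unit_disk. 0 \<le> Re (euler_op 1 (quot f) z))"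
    if f: "f \<in> class_A" for f
  proof
    have eq: "euler_op 1 (quot f) z = disk_deriv f z" if "z \<in> unit_disk" for z
      using that by (simp add: disk_deriv_def deriv_class_A[OF f])
    have hol: "euler_op 1 (quot f) holomorphic_on unit_disk"
      by (intro holomorphic_euler_op quot_class_A f open_ball)
    show "disk_deriv f \<in> class_P" if nonneg: "\<forall>z\<in>unit_disk. 0 \<le> Re (euler_op 1 (quot f) z)"
    proof -
      have "0 < Re (disk_deriv f z)" if "z \<in> unit_disk" for z
        using holomorphic_Re_pos[OF hol open_ball connected_ball, of 0 z] nonneg that eq[OF that]
          euler_op_quot_0[OF f] by simp
      moreover have "disk_deriv f holomorphic_on unit_disk"
        by (rule holomorphic_transform[OF hol eq])
      moreover have "disk_deriv f 0 = 1" using eq[of 0] euler_op_quot_0[OF f] by simp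
      ultimately show ?thesis by (simp add: class_P_def disk_deriv_def)
    qed
    show "\<forall>z\<in>unit_disk. 0 \<le> Re (euler_op 1 (quot f) z)" if "disk_deriv f \<in> class_P"
      using that eq by (auto simp: class_P_def intro: less_imp_le)
  qed
  then show ?thesis
    by (auto simp: frakA_iff class_R_def)
qed

section \<open>The functions \<open>f_fun \<alpha>\<close> and total extremality\<close>

text \<open>Produces members of \<open>class_A\<close> with a prescribed quotient; used for
  \<open>f_fun\<close> and \<open>disk_id\<close>.\<close>

lemma class_A_mult_id:
  assumes P: "P holomorphic_on unit_disk" "P 0 = 1"
  shows "(\<lambda>z\<in>unit_disk. z * P z) \<in> class_A"
    and "z \<in> unit_disk \<Longrightarrow> quot (\<lambda>z\<in>unit_disk. z * P z) z = P z"
proof -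
  let ?f = "\<lambda>z\<in>unit_disk. z * P z"
  have "(P has_field_derivative deriv P 0) (at 0)"
    by (intro holomorphic_derivI[OF P(1)]) auto
  then have "((\<lambda>z. z * P z) has_field_derivative 1) (at 0)"
    using P by (auto intro!: derivative_eq_intros)
  then have "(?f has_field_derivative 1) (at 0)"
    by (rule has_field_derivative_transform_within_open[OF _ open_ball[of 0 1]]) auto
  moreover have "?f holomorphic_on unit_disk"
    by (rule holomorphic_transform[of "\<lambda>z. z * P z"]) (auto intro!: holomorphic_intros P)
  ultimately show A: "?f \<in> class_A"
    by (simp add: class_A_def DERIV_imp_deriv)
  show "quot ?f z = P z" if "z \<in> unit_disk"
    using that quot_class_A(2)[OF A] P(2) by (cases "z = 0") (auto simp: quot_def)
qed

lemma f_fun_class_A: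
  assumes \<alpha>: "\<alpha> \<le> 1"
  shows "f_fun \<alpha> \<in> class_A" and "z \<in> unit_disk \<Longrightarrow> quot (f_fun \<alpha>) z = F_fun \<alpha> (- z)"
proof -
  have "(\<lambda>z. F_fun \<alpha> (- z)) holomorphic_on unit_disk"
    by (rule holomorphic_on_compose_gen[OF _ holomorphic_F_fun[OF \<alpha>], of uminus, unfolded o_def])
      (auto intro!: holomorphic_intros)
  moreover have "F_fun \<alpha> (- 0) = 1"
    using euler_op_F_fun[OF \<alpha>, of 0] by (simp add: euler_op_def F1_def)
  ultimately show "f_fun \<alpha> \<in> class_A" "z \<in> unit_disk \<Longrightarrow> quot (f_fun \<alpha>) z = F_fun \<alpha> (- z)"
    unfolding f_fun_def using class_A_mult_id[of "\<lambda>z. F_fun \<alpha> (- z)"] by blast+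
qed

text \<open>The operator commutes with the reflection \<open>z\<close> to \<open>- z\<close>, as the
  two signs in \<open>z p'\<close> cancel.\<close>

lemma euler_op_quot_f_fun:
  assumes \<alpha>: "\<alpha> \<le> 1" and z: "z \<in> unit_disk"
  shows "euler_op (1 - \<alpha>) (quot (f_fun \<alpha>)) z = F1 (- z)"
proof -
  have "(F_fun \<alpha> has_field_derivative deriv (F_fun \<alpha>) (- z)) (at (- z))"
    using z by (intro holomorphic_derivI[OF holomorphic_F_fun[OF \<alpha>]]) auto
  from DERIV_chain2[OF this DERIV_minus[OF DERIV_ident]]
  have "((\<lambda>z. F_fun \<alpha> (- z)) has_field_derivative - deriv (F_fun \<alpha>) (- z)) (at z)"
    by simp
  then have "(quot (f_fun \<alpha>) has_field_derivative - deriv (F_fun \<alpha>) (- z)) (at z)"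
    by (rule has_field_derivative_transform_within_open[OF _ open_ball z])
      (simp add: f_fun_class_A(2)[OF \<alpha>])
  then have "deriv (quot (f_fun \<alpha>)) z = - deriv (F_fun \<alpha>) (- z)"
    by (rule DERIV_imp_deriv)
  then have "euler_op (1 - \<alpha>) (quot (f_fun \<alpha>)) z = euler_op (1 - \<alpha>) (F_fun \<alpha>) (- z)"
    using z by (simp add: euler_op_def f_fun_class_A(2)[OF \<alpha>])
  also have "\<dots> = F1 (- z)" using z by (intro euler_op_F_fun \<alpha>) auto
  finally show ?thesis .
qed

text \<open>The real part is the Poisson kernel \<open>(1 - |z|^2) / |1 - z|^2\<close>; at
  \<open>z = 1\<close> division by zero gives the value 0.\<close>

lemma Re_F1_nonneg:
  assumes "norm z \<le> 1"
  shows "0 \<le> Re (F1 z)"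
proof -
  have "(norm z)\<^sup>2 \<le> 1" using assms by (simp add: power_le_one)
  then have "0 \<le> (1 + Re z) * (1 - Re z) - Im z * Im z"
    unfolding cmod_power2 by (simp add: power2_eq_square algebra_simps)
  then show ?thesis by (simp add: F1_def Re_divide)
qed

lemma f_fun_in_frakA: "\<alpha> \<le> 1 \<Longrightarrow> f_fun \<alpha> \<in> frakA \<alpha>"
  by (simp add: frakA_iff f_fun_class_A euler_op_quot_f_fun Re_F1_nonneg)

lemma totally_extremal_f_fun:
  assumes \<alpha>: "\<alpha> \<le> 1"
  shows "totally_extremal (f_fun \<alpha>) (frakA \<alpha>)"
  unfolding totally_extremal_def
proof (intro conjI allI ballI)
  fix c f and r :: real
  assume r: "r \<in> {0..<1}" and f: "f \<in> frakA \<alpha>"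
  have fA: "f \<in> class_A" using f by (simp add: frakA_iff)
  obtain z where z: "z \<in> sphere 0 r" "min_on_circle c r f = Re (c * quot f z)"
    by (rule min_on_circle_attained[OF fA r, of c])
  have le: "min_on_circle c r (f_fun \<alpha>) \<le> Re (c * quot (f_fun \<alpha>) w)" if w: "w \<in> sphere 0 r" for w
  proof (rule min_on_circle_attained[OF f_fun_class_A(1)[OF \<alpha>] r, of c])
    fix z
    assume "min_on_circle c r (f_fun \<alpha>) = Re (c * quot (f_fun \<alpha>) z)"
      and "\<And>w. w \<in> sphere 0 r \<Longrightarrow> Re (c * quot (f_fun \<alpha>) z) \<le> Re (c * quot (f_fun \<alpha>) w)"
    with w show ?thesis by (simp only:)
  qed
  have zd: "z \<in> unit_disk" using z(1) r by simp
  have "min_on_circle c r (f_fun \<alpha>) \<le> Re (c * quot f z)"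
  proof (rule Re_ge_if_F_fun_Re_ge[OF \<alpha> _ _ _ zd])
    show "quot f holomorphic_on unit_disk" "quot f 0 = 1" by (fact quot_class_A[OF fA])+
    show "0 \<le> Re (euler_op (1 - \<alpha>) (quot f) w)" if "w \<in> unit_disk" for w
      using f that by (simp add: frakA_iff)
    fix w :: complex assume w: "norm w = norm z"
    \<comment> \<open>The circle is symmetric, so the reflection built into \<open>f_fun\<close>
      leaves the minimum unchanged.\<close>
    then have "- w \<in> sphere 0 r" "- w \<in> unit_disk" using z(1) r by auto
    then show "min_on_circle c r (f_fun \<alpha>) \<le> Re (c * F_fun \<alpha> w)"
      using le[of "- w"] f_fun_class_A(2)[OF \<alpha>, of "- w"] by (simp only: minus_minus)
  qed
  then show "min_on_circle c r (f_fun \<alpha>) \<le> min_on_circle c r f" by (simp only: z(2))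
qed (use f_fun_in_frakA[OF \<alpha>] in \<open>auto simp: frakA_iff\<close>)

section \<open>Separation of the classes by the first coefficient\<close>

lemma deriv_euler_op_0:
  assumes p: "p holomorphic_on unit_disk"
  shows "deriv (euler_op b p) 0 = of_real (1 + b) * deriv p 0"
proof -
  have "(p has_field_derivative deriv p 0) (at 0)"
    by (intro holomorphic_derivI[OF p]) auto
  moreover have "(deriv p has_field_derivative deriv (deriv p) 0) (at 0)"
    by (intro holomorphic_derivI[OF holomorphic_deriv[OF p open_ball]]) auto
  ultimately have "(euler_op b p has_field_derivative of_real (1 + b) * deriv p 0) (at 0)"
    unfolding euler_op_def[abs_def] by (auto intro!: derivative_eq_intros simp: algebra_simps)
  then show ?thesis by (rule DERIV_imp_deriv)
qed

text \<open>Here \<open>(2 - \<alpha>) * norm (deriv ?p 0) = 2\<close>, so the larger factor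
  \<open>2 - \<beta>\<close> would break the coefficient bound 2.\<close>

lemma f_fun_notin_frakA:
  assumes "\<beta> < \<alpha>" and \<alpha>: "\<alpha> \<le> 1"
  shows "f_fun \<alpha> \<notin> frakA \<beta>"
proof
  assume f: "f_fun \<alpha> \<in> frakA \<beta>"
  let ?p = "quot (f_fun \<alpha>)"
  have A: "f_fun \<alpha> \<in> class_A" by (rule f_fun_class_A[OF \<alpha>])
  note p = quot_class_A(1)[OF A]
  have "((\<lambda>z. F1 (- z)) has_field_derivative - 2) (at 0)"
    unfolding F1_def by (auto intro!: derivative_eq_intros)
  then have "(euler_op (1 - \<alpha>) ?p has_field_derivative - 2) (at 0)"
    by (rule has_field_derivative_transform_within_open[OF _ open_ball[of 0 1]])
      (simp_all add: euler_op_quot_f_fun[OF \<alpha>])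
  then have "of_real (1 + (1 - \<alpha>)) * deriv ?p 0 = - 2"
    using deriv_euler_op_0[OF p] DERIV_imp_deriv by metis
  then have "\<bar>1 + (1 - \<alpha>)\<bar> * norm (deriv ?p 0) = 2"
    by (metis norm_minus_cancel norm_mult norm_numeral norm_of_real)
  then have eq: "(2 - \<alpha>) * norm (deriv ?p 0) = 2" using \<alpha> by simp
  have "norm (deriv (euler_op (1 - \<beta>) ?p) 0) \<le> 2"
    using f by (intro Caratheodory_coeff_1 holomorphic_euler_op p open_ball euler_op_quot_0 A)
      (simp add: frakA_iff)
  then have "\<bar>1 + (1 - \<beta>)\<bar> * norm (deriv ?p 0) \<le> 2"
    unfolding deriv_euler_op_0[OF p] norm_mult norm_of_real .
  then have "(2 - \<beta>) * norm (deriv ?p 0) \<le> (2 - \<alpha>) * norm (deriv ?p 0)"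
    using assms eq by simp
  moreover have "norm (deriv ?p 0) > 0" 
    using eq by (cases "deriv ?p 0 = 0") auto
  ultimately show False using assms by simp
qed

section \<open>The intersection of the classes and the conclusion\<close>

lemma Inter_frakA: "(\<Inter>\<alpha>\<in>{..<1}. frakA \<alpha>) = {disk_id}"
proof (intro equalityI subsetI)
  have id: "disk_id = (\<lambda>z\<in>unit_disk. z * 1)" by (simp add: disk_id_def)
  have A: "disk_id \<in> class_A" and q: "z \<in> unit_disk \<Longrightarrow> quot disk_id z = 1" for z
    unfolding id by (rule class_A_mult_id; simp)+
  have "deriv (quot disk_id) z = 0" if "z \<in> unit_disk" for z
    by (rule DERIV_imp_deriv, rule has_field_derivative_transform_within_open[OF DERIV_const open_ball that])
      (simp add: q)
  then have "disk_id \<in> frakA \<alpha>" for \<alpha>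
    using A q by (simp add: frakA_iff euler_op_def)
  then show "f \<in> (\<Inter>\<alpha>\<in>{..<1}. frakA \<alpha>)" if "f \<in> {disk_id}" for f
    using that by simp
next
  fix f assume f: "f \<in> (\<Inter>\<alpha>\<in>{..<1}. frakA \<alpha>)"
  have A: "f \<in> class_A" using INT_D[OF f, of 0] by (simp add: frakA_iff)
  let ?p = "quot f"
  note p = quot_class_A[OF A]
  have *: "0 \<le> Re (?p z) + b * Re (z * deriv ?p z)" if "0 < b" "z \<in> unit_disk" for b z
  proof -
    have "f \<in> frakA (1 - b)" using f that(1) by auto
    then have "0 \<le> Re (euler_op b ?p z)" using that(2) by (auto simp: frakA_iff)
    then show ?thesis by (simp add: euler_op_def algebra_simps)
  qed
  have nonneg: "0 \<le> Re (z * deriv ?p z)" if z: "z \<in> unit_disk" for z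
  proof (rule ccontr)
    assume neg: "\<not> 0 \<le> Re (z * deriv ?p z)"
    define x where "x = Re (z * deriv ?p z)"
    \<comment> \<open>Chosen so that \<open>b * x\<close> is
      \<open>- (\<bar>Re (?p z)\<bar> + 1)\<close>, which outweighs
      \<open>Re (?p z)\<close>.\<close>
    define b where "b = (\<bar>Re (?p z)\<bar> + 1) / - x"
    have x: "x < 0" using neg by (simp only: x_def not_le)
    then have "b * x = - (\<bar>Re (?p z)\<bar> + 1)" by (simp add: b_def)
    moreover have "0 < b" unfolding b_def using x by (intro divide_pos_pos) auto
    ultimately show False using *[of b z] z unfolding x_def[symmetric] by linarith
  qed
  have hol: "(\<lambda>z. z * deriv ?p z) holomorphic_on unit_disk"
    by (intro holomorphic_intros holomorphic_deriv p open_ball)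
  have zero: "z * deriv ?p z = 0" if "z \<in> unit_disk" for z
    using holomorphic_const_if_Re_nonneg_zero[OF hol open_ball connected_ball nonneg _ _ that, of 0] by simp
  have "?p z = 1" if z: "z \<in> unit_disk" for z
  proof -
    have "?p constant_on unit_disk"
    \<comment> \<open>The origin is an exceptional point, since \<open>z * deriv ?p z = 0\<close>
      says nothing about the derivative there.\<close>
    proof (rule DERIV_zero_connected_constant_on[of _ "{0}"])
      show "continuous_on unit_disk ?p" by (rule holomorphic_on_imp_continuous_on[OF p(1)])
      show "\<forall>w\<in>unit_disk - {0}. (?p has_field_derivative 0) (at w)"
      proof
        fix w :: complex assume w: "w \<in> unit_disk - {0}"
        then have "deriv ?p w = 0" using zero[of w] by simp
        then show "(?p has_field_derivative 0) (at w)"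
          using holomorphic_derivI[OF p(1) open_ball, of w] w by auto
      qed
    qed auto
    then show ?thesis using z p(2) by (metis constant_on_def centre_in_ball zero_less_one)
  qed
  then have "f z = disk_id z" if "z \<in> unit_disk" for z
    using p(3)[OF that] that by (simp add: disk_id_def)
  moreover have "f \<in> extensional unit_disk" "disk_id \<in> extensional unit_disk"
    using A by (simp_all add: class_A_def disk_id_def)
  ultimately show "f \<in> {disk_id}" using extensionalityI by blast
qed

theorem theorem4p9:
  shows "(filtration_G0 {..1} frakA \<and>
          (\<Inter>\<alpha>\<in>{..<1}. frakA \<alpha>) = {disk_id} \<and>
          frakA 0 = class_R \<and>
          frakA 1 = class_G0) \<and>
         (\<forall>\<alpha>\<in>{..1}. totally_extremal (f_fun \<alpha>) (frakA \<alpha>)) \<and>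
         (\<forall>\<alpha>\<in>{..1}. f_fun \<alpha> \<in> filtration_boundary {..1} frakA \<alpha>) \<and>
         strict_filtration_G0 {..1} frakA"
proof (intro conjI ballI)
  show filt: "filtration_G0 {..1} frakA"
    \<comment> \<open>As \<open>class_G0\<close> is the top class \<open>frakA 1\<close>,
      monotonicity also gives the containment in it.\<close>
    using frakA_mono by (auto simp: filtration_G0_def frakA_1[symmetric])
  show "f_fun \<alpha> \<in> filtration_boundary {..1} frakA \<alpha>" if "\<alpha> \<in> {..1}" for \<alpha>
    using that f_fun_in_frakA f_fun_notin_frakA by (auto simp: filtration_boundary_def)
  show "strict_filtration_G0 {..1} frakA"
    unfolding strict_filtration_G0_def
  proof (intro conjI ballI impI filt)
    fix s t :: real assume "s \<in> {..1}" "t \<in> {..1}" "s < t"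
    then show "frakA s \<subset> frakA t"
      \<comment> \<open>The function \<open>f_fun t\<close> witnesses that the inclusion is
        proper.\<close>
      using frakA_mono[of s t] f_fun_in_frakA[of t] f_fun_notin_frakA[of s t] by auto
  qed
qed (use Inter_frakA frakA_0 frakA_1 totally_extremal_f_fun in auto)

end
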